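(* Let $p\in(0,\infty)$ and let $x\in\Sigma$. Let $\Phi_1,\Psi_1,\Phi_2,\Psi_2:\mathbb N\to(0,\infty)$ be the functions associated with $p$ and $x$. The following statements (i) to (v) are equivalent. (i) The block decomposition of $x$ is regular. (ii) There is $a>0$ such that $\Phi_1(n)\le a\,n\,\Phi_2(n)$ for all $n\in\mathbb N$. (iii) There is $b>0$ such that $n\Psi_2(n)\le b\,\Psi_1(n)$ for all $n\in\mathbb N$. (iv) There are $a_1,a_2>0$ such that, for all $n\in\mathbb N$, $a_1n\Phi_2(n)\le\Phi_1(n)\le a_2n\Phi_2(n)$. (v) There are $b_1,b_2>0$ such that, for all $n\in\mathbb N$, $b_1n\Psi_2(n)\le\Psi_1(n)\le b_2n\Psi_2(n)$.
   Context: $\mathbb N=\{1,2,3,\dots\}$. $\Sigma$ is the set of $x\in[0,1)$ that are not binary rationals (a binary rational is $0$ or a number $k/2^n$ with $k,n\in\mathbb N$, $1\le k<2^n$). Each $x\in\Sigma$ has a unique binary expansion $x=\sum_{k\ge1}d_k/2^k$, $d_k\in\{0,1\}$, and its digits are neither eventually all $0$ nor eventually all $1$. Block decomposition: for $x\in\Sigma$ the digit sequence $d_1d_2d_3\dots$ is written uniquely as juxtaposed finite blocks $C_0B_1C_1B_2C_2\cdots$, where each $B_j$ ($j\ge1$) is a non-empty block of zeros, each $C_j$ ($j\ge1$) is a non-empty block of ones, and $C_0$ is a (possibly empty) block of ones. Let $\ell_j\ge1$ be the length of $B_j$ ($j\ge1$) and $m_j$ the length of $C_j$ ($j\ge0$),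 so $m_j\ge1$ for $j\ge1$ and $m_0\ge0$. Let $J_j\subset\mathbb N$ be the set of positions occupied by $B_j$ and $K_j$ the set of positions occupied by $C_j$: with $s_0=0$, $t_0=m_0$, $s_j=t_{j-1}+\ell_j$, $t_j=s_j+m_j$ for $j\ge1$, one has $J_j=\{t_{j-1}+1,\dots,s_j\}$ for $j\ge 1$ and $K_j=\{s_j+1,\dots,t_j\}$ for $j\ge0$ ($K_0=\emptyset$ if $C_0$ is empty). The sets $K_0,J_1,K_1,J_2,K_2,\dots$ partition $\mathbb N$. Definition of $\Phi_1,\Psi_1$: if $n\in K_0\cup J_1\cup K_1$, $\Phi_1(n)=\Psi_1(n)=1$. If $n\in J_j$ with $j\ge2$, $\Phi_1(n)=\Psi_1(n)=\sum_{u=1}^j2^{p\ell_u}+\sum_{u=1}^{j-1}m_u$. If $n\in K_j$ with $j\ge2$, $\Phi_1(n)=\sum_{u=1}^j2^{p\ell_u}+\sum_{u=1}^{j-1}m_u$ and $\Psi_1(n)=\sum_{u=1}^j2^{p\ell_u}+\sum_{u=1}^{j}m_u$. Definition of $\Phi_2,\Psi_2$: if $n\in K_0\cup J_1\cup K_1$, $\Phi_2(n)=\Psi_2(n)=1$. If $n\in J_j$ with $j\ge2$, $$\Phi_2(n)=\frac{\Phi_1(n)}{\sum_{u=1}^j\ell_u+\sum_{u=1}^{j-1}m_u},\qquad \Psi_2(n)=\frac{\Psi_1(n)}{\sum_{u=1}^{j-1}\ell_u+\sum_{u=1}^{j-1}m_u}.$$ If $n\in K_j$ with $j\ge2$, $$\Phi_2(n)=\frac{\Phi_1(n)}{\sum_{u=1}^j\ell_u+\sum_{u=1}^{j}m_u},\qquad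 \Psi_2(n)=\frac{\Psi_1(n)}{\sum_{u=1}^{j}\ell_u+\sum_{u=1}^{j-1}m_u}.$$ The block decomposition of $x\in\Sigma$ is called regular if there is $C>0$ such that for all $j\ge2$, $$\max\left(\frac{\ell_j}{\sum_{u=1}^{j-1}\ell_u+\sum_{u=1}^{j-1}m_u},\ \frac{m_j}{\sum_{u=1}^{j}\ell_u+\sum_{u=1}^{j-1}m_u}\right)\le C.$$ *)

theory Defs
  imports Complex_Main "HOL-Library.FuncSet"
begin

text \<open>The set of positive integers is rendered as the part n \<ge> 1 of the type nat.  Functions on
  positive integers that are singled out by a description are taken extensional
  (value undefined at 0), so that the description determines them.\<close>

definition binary_rational :: "real \<Rightarrow> bool" where
  "binary_rational x \<longleftrightarrow>
     x = 0 \<or> (\<exists>k n :: nat. 1 \<le> n \<and> 1 \<le> k \<and> k < 2 ^ n \<and> x = real k / 2 ^ n)"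

definition Sigma_set :: "real set" where
  "Sigma_set = {x. 0 \<le> x \<and> x < 1 \<and> \<not> binary_rational x}"

definition is_binary_expansion :: "real \<Rightarrow> (nat \<Rightarrow> nat) \<Rightarrow> bool" where
  "is_binary_expansion x d \<longleftrightarrow>
     d \<in> {1..} \<rightarrow>\<^sub>E {0, 1} \<and> (\<lambda>k. real (d (Suc k)) / 2 ^ Suc k) sums x"

definition binary_digit :: "real \<Rightarrow> nat \<Rightarrow> nat" where
  "binary_digit x = (THE d. is_binary_expansion x d)"

text \<open>In what follows l j (for j \<ge> 1) is the length of the j-th block of zeros and m j (for j \<ge> 0)
  the length of the j-th block of ones; these blocks end at the positions
  zero_end l m j and one_end l m j.\<close>

primrec zero_end :: "(nat \<Rightarrow> nat) \<Rightarrow> (nat \<Rightarrow> nat) \<Rightarrow> nat \<Rightarrow> nat" where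
  "zero_end l m 0 = 0"
| "zero_end l m (Suc j) = (zero_end l m j + m j) + l (Suc j)"

definition one_end :: "(nat \<Rightarrow> nat) \<Rightarrow> (nat \<Rightarrow> nat) \<Rightarrow> nat \<Rightarrow> nat" where
  "one_end l m j = zero_end l m j + m j"

text \<open>Only used for j \<ge> 1.\<close>

definition zero_positions :: "(nat \<Rightarrow> nat) \<Rightarrow> (nat \<Rightarrow> nat) \<Rightarrow> nat \<Rightarrow> nat set" where
  "zero_positions l m j = {one_end l m (j - 1) + 1 .. zero_end l m j}"

definition one_positions :: "(nat \<Rightarrow> nat) \<Rightarrow> (nat \<Rightarrow> nat) \<Rightarrow> nat \<Rightarrow> nat set" where
  "one_positions l m j = {zero_end l m j + 1 .. one_end l m j}"

definition is_block_decomposition :: "(nat \<Rightarrow> nat) \<Rightarrow> (nat \<Rightarrow> nat) \<Rightarrow> (nat \<Rightarrow> nat) \<Rightarrow> bool" where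
  "is_block_decomposition d l m \<longleftrightarrow>
     l \<in> {1..} \<rightarrow>\<^sub>E {1..} \<and> (\<forall>j\<ge>1. m j \<ge> 1) \<and>
     (\<forall>j\<ge>1. \<forall>n\<in>zero_positions l m j. d n = 0) \<and>
     (\<forall>j. \<forall>n\<in>one_positions l m j. d n = 1)"

definition block_lengths :: "real \<Rightarrow> (nat \<Rightarrow> nat) \<times> (nat \<Rightarrow> nat)" where
  "block_lengths x = (THE (l, m). is_block_decomposition (binary_digit x) l m)"

definition zero_len :: "real \<Rightarrow> nat \<Rightarrow> nat" where
  "zero_len x = fst (block_lengths x)"

definition one_len :: "real \<Rightarrow> nat \<Rightarrow> nat" where
  "one_len x = snd (block_lengths x)"

definition zero_block :: "real \<Rightarrow> nat \<Rightarrow> nat set" where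
  "zero_block x = zero_positions (zero_len x) (one_len x)"

definition one_block :: "real \<Rightarrow> nat \<Rightarrow> nat set" where
  "one_block x = one_positions (zero_len x) (one_len x)"

text \<open>The function with value 1 on the first three blocks, f j on the j-th block of zeros and g j on
  the j-th block of ones, for j \<ge> 2; see the lemma blockwise_eq below.\<close>

definition blockwise :: "real \<Rightarrow> (nat \<Rightarrow> real) \<Rightarrow> (nat \<Rightarrow> real) \<Rightarrow> nat \<Rightarrow> real" where
  "blockwise x f g n =
     (if n \<in> one_block x 0 \<union> zero_block x 1 \<union> one_block x 1 then 1
      else if \<exists>j\<ge>2. n \<in> zero_block x j then f (THE j. j \<ge> 2 \<and> n \<in> zero_block x j)
      else g (THE j. j \<ge> 2 \<and> n \<in> one_block x j))"

definition Phi1 :: "real \<Rightarrow> real \<Rightarrow> nat \<Rightarrow> real" where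
  "Phi1 p x = blockwise x
     (\<lambda>j. (\<Sum>u=1..j. 2 powr (p * real (zero_len x u))) + (\<Sum>u=1..j-1. real (one_len x u)))
     (\<lambda>j. (\<Sum>u=1..j. 2 powr (p * real (zero_len x u))) + (\<Sum>u=1..j-1. real (one_len x u)))"

definition Psi1 :: "real \<Rightarrow> real \<Rightarrow> nat \<Rightarrow> real" where
  "Psi1 p x = blockwise x
     (\<lambda>j. (\<Sum>u=1..j. 2 powr (p * real (zero_len x u))) + (\<Sum>u=1..j-1. real (one_len x u)))
     (\<lambda>j. (\<Sum>u=1..j. 2 powr (p * real (zero_len x u))) + (\<Sum>u=1..j. real (one_len x u)))"

definition Phi2 :: "real \<Rightarrow> real \<Rightarrow> nat \<Rightarrow> real" where
  "Phi2 p x n = blockwise x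
     (\<lambda>j. Phi1 p x n / ((\<Sum>u=1..j. real (zero_len x u)) + (\<Sum>u=1..j-1. real (one_len x u))))
     (\<lambda>j. Phi1 p x n / ((\<Sum>u=1..j. real (zero_len x u)) + (\<Sum>u=1..j. real (one_len x u)))) n"

definition Psi2 :: "real \<Rightarrow> real \<Rightarrow> nat \<Rightarrow> real" where
  "Psi2 p x n = blockwise x
     (\<lambda>j. Psi1 p x n / ((\<Sum>u=1..j-1. real (zero_len x u)) + (\<Sum>u=1..j-1. real (one_len x u))))
     (\<lambda>j. Psi1 p x n / ((\<Sum>u=1..j. real (zero_len x u)) + (\<Sum>u=1..j-1. real (one_len x u)))) n"

definition regular_decomposition :: "real \<Rightarrow> bool" where
  "regular_decomposition x \<longleftrightarrow> (\<exists>C>0. \<forall>j\<ge>2.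
     max (real (zero_len x j)
            / ((\<Sum>u=1..j-1. real (zero_len x u)) + (\<Sum>u=1..j-1. real (one_len x u))))
         (real (one_len x j)
            / ((\<Sum>u=1..j. real (zero_len x u)) + (\<Sum>u=1..j-1. real (one_len x u))))
       \<le> C)"


subsection \<open>The binary expansion exists and is unique\<close>

lemma Sigma_set_not_int:
  assumes "x \<in> Sigma_set"
  shows "2 ^ k * x \<noteq> of_int z"
proof
  assume eq: "2 ^ k * x = of_int z"
  have x: "0 \<le> x" "x < 1" "\<not> binary_rational x"
    using assms by (auto simp: Sigma_set_def)
  have xz: "x = of_int z / 2 ^ k"
    using eq by (simp add: field_simps)
  have "0 \<le> (of_int z :: real)"
    unfolding eq[symmetric] using x by simp
  then have z0: "0 \<le> z" by simp
  have "(of_int z :: real) < 2 ^ k"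
    unfolding eq[symmetric] using x by simp
  then have "real (nat z) < real (2 ^ k)"
    using z0 by simp
  then have zk: "nat z < 2 ^ k"
    by (simp only: of_nat_less_iff)
  have "x \<noteq> 0" using x by (auto simp: binary_rational_def)
  then have "z \<noteq> 0" using xz by auto
  then have z1: "1 \<le> nat z" using z0 by auto
  then have "k \<noteq> 0" using zk by (cases k) auto
  moreover have "x = real (nat z) / 2 ^ k"
    using xz z0 by simp
  ultimately have "binary_rational x"
    unfolding binary_rational_def using z1 zk
    by (metis One_nat_def Suc_leI neq0_conv)
  then show False using x by simp
qed

lemma expansion_bounds:
  assumes "\<And>i. e i \<in> {0, 1 :: nat}" "(\<lambda>i. real (e i) / 2 ^ Suc i) sums y"
  shows "0 \<le> y" "y \<le> 1"
proof -
  show "0 \<le> y"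
    by (rule sums_le[OF _ sums_zero assms(2)]) simp
  have "real (e i) / 2 ^ Suc i \<le> (1 / 2) ^ Suc i" for i
    using assms(1)[of i] by (auto simp: power_divide)
  then show "y \<le> 1"
    by (rule sums_le[OF _ assms(2) power_half_series])
qed

lemma expansion_shift:
  assumes "(\<lambda>i. real (e i) / 2 ^ Suc i) sums y"
  shows "(\<lambda>i. real (e (Suc i)) / 2 ^ Suc i) sums (2 * y - real (e 0))"
proof -
  have "(\<lambda>i. real (e (Suc i)) / 2 ^ Suc (Suc i)) sums (y - real (e 0) / 2)"
    using assms by (subst sums_Suc_iff) simp
  from sums_mult[OF this, of 2] show ?thesis
    by (simp add: algebra_simps)
qed

lemma binary_expansion_shift:
  assumes "is_binary_expansion x d"
  shows "\<exists>N::int. (\<lambda>i. real (d (Suc (i + k))) / 2 ^ Suc i) sums (2 ^ k * x - of_int N)"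
proof (induction k)
  case 0
  show ?case using assms by (intro exI[of _ 0]) (simp add: is_binary_expansion_def)
next
  case (Suc k)
  then obtain N :: int where
    "(\<lambda>i. real (d (Suc (i + k))) / 2 ^ Suc i) sums (2 ^ k * x - of_int N)" by blast
  from expansion_shift[OF this]
  have "(\<lambda>i. real (d (Suc (i + Suc k))) / 2 ^ Suc i)
          sums (2 ^ Suc k * x - of_int (2 * N + int (d (Suc k))))"
    by (simp add: algebra_simps)
  then show ?case by blast
qed

lemma binary_expansion_range:
  assumes "is_binary_expansion x d"
  shows "d (Suc i) \<in> {0, 1}"
  using assms by (auto simp: is_binary_expansion_def PiE_iff)

lemma binary_expansion_not_eventually:
  assumes "x \<in> Sigma_set" "is_binary_expansion x d"
  shows "\<exists>n\<ge>k. d (Suc n) = 0" "\<exists>n\<ge>k. d (Suc n) = 1"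
proof -
  obtain N :: int where
    N: "(\<lambda>i. real (d (Suc (i + k))) / 2 ^ Suc i) sums (2 ^ k * x - of_int N)"
    using binary_expansion_shift[OF assms(2)] by blast
  show "\<exists>n\<ge>k. d (Suc n) = 0"
  proof (rule ccontr)
    assume "\<not> (\<exists>n\<ge>k. d (Suc n) = 0)"
    then have "d (Suc (i + k)) = 1" for i
      using binary_expansion_range[OF assms(2), of "i + k"] by (metis empty_iff insert_iff le_add2)
    then have "(\<lambda>i. (1 / 2) ^ Suc i) sums (2 ^ k * x - of_int N)"
      using N by (simp add: power_divide)
    then have "2 ^ k * x - of_int N = 1"
      using power_half_series sums_unique2 by blast
    then have "2 ^ k * x = of_int (N + 1)" by simp
    then show False using Sigma_set_not_int[OF assms(1)] by blast
  qed
  show "\<exists>n\<ge>k. d (Suc n) = 1"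
  proof (rule ccontr)
    assume "\<not> (\<exists>n\<ge>k. d (Suc n) = 1)"
    then have "d (Suc (i + k)) = 0" for i
      using binary_expansion_range[OF assms(2), of "i + k"] by (metis empty_iff insert_iff le_add2)
    then have "(\<lambda>i. 0) sums (2 ^ k * x - of_int N)"
      using N by simp
    then have "2 ^ k * x - of_int N = 0"
      using sums_zero sums_unique2 by blast
    then have "2 ^ k * x = of_int N" by simp
    then show False using Sigma_set_not_int[OF assms(1)] by blast
  qed
qed

lemma binary_expansion_unique:
  assumes x: "x \<in> Sigma_set" and d: "is_binary_expansion x d" and e: "is_binary_expansion x e"
  shows "d = e"
proof -
  have first: "d (Suc k) \<le> e (Suc k)"
    if d: "is_binary_expansion x d" and e: "is_binary_expansion x e"
      and sd: "(\<lambda>i. real (d (Suc (i + k))) / 2 ^ Suc i) sums (2 ^ k * x - of_int N)"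
      and se: "(\<lambda>i. real (e (Suc (i + k))) / 2 ^ Suc i) sums (2 ^ k * x - of_int N)"
    for d e :: "nat \<Rightarrow> nat" and k and N :: int
  proof (rule ccontr)
    assume "\<not> d (Suc k) \<le> e (Suc k)"
    then have dk: "d (Suc k) = 1" "e (Suc k) = 0"
      using binary_expansion_range[OF d, of k] binary_expansion_range[OF e, of k] by auto
    have "0 \<le> 2 * (2 ^ k * x - of_int N) - real (d (Suc (0 + k)))"
      by (rule expansion_bounds(1)[OF _ expansion_shift[OF sd]])
         (use binary_expansion_range[OF d] in auto)
    moreover have "2 * (2 ^ k * x - of_int N) - real (e (Suc (0 + k))) \<le> 1"
      by (rule expansion_bounds(2)[OF _ expansion_shift[OF se]])
         (use binary_expansion_range[OF e] in auto)
    ultimately have "2 ^ Suc k * x = of_int (2 * N + 1)"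
      using dk by simp
    then show False using Sigma_set_not_int[OF x] by blast
  qed
  have same: "\<exists>N::int. (\<lambda>i. real (d (Suc (i + k))) / 2 ^ Suc i) sums (2 ^ k * x - of_int N) \<and>
             (\<lambda>i. real (e (Suc (i + k))) / 2 ^ Suc i) sums (2 ^ k * x - of_int N)" for k
  proof (induction k)
    case 0
    show ?case using d e by (intro exI[of _ 0]) (simp add: is_binary_expansion_def)
  next
    case (Suc k)
    then obtain N :: int where
      sd: "(\<lambda>i. real (d (Suc (i + k))) / 2 ^ Suc i) sums (2 ^ k * x - of_int N)" and
      se: "(\<lambda>i. real (e (Suc (i + k))) / 2 ^ Suc i) sums (2 ^ k * x - of_int N)" by blast
    have eq: "d (Suc k) = e (Suc k)"
      using first[OF d e sd se] first[OF e d se sd] by simp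
    have "(\<lambda>i. real (d (Suc (i + Suc k))) / 2 ^ Suc i)
            sums (2 ^ Suc k * x - of_int (2 * N + int (d (Suc k))))"
      using expansion_shift[OF sd] by (simp add: algebra_simps)
    moreover have "(\<lambda>i. real (e (Suc (i + Suc k))) / 2 ^ Suc i)
            sums (2 ^ Suc k * x - of_int (2 * N + int (d (Suc k))))"
      using expansion_shift[OF se] eq by (simp add: algebra_simps)
    ultimately show ?case by blast
  qed
  have "d (Suc k) = e (Suc k)" for k
    using same[of k] first[OF d e] first[OF e d] by (meson le_antisym)
  then have "d n = e n" if "n \<in> {1..}" for n
    using that by (cases n) auto
  then show ?thesis
    using d e by (intro PiE_ext[of d "{1..}" "\<lambda>_. {0,1}" e]) (auto simp: is_binary_expansion_def)
qed

lemma binary_expansion_exists: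
  assumes "x \<in> Sigma_set"
  shows "\<exists>d. is_binary_expansion x d"
proof -
  define b where "b k = nat (\<lfloor>2 ^ k * x\<rfloor> mod 2)" for k :: nat
  have x: "0 \<le> x" "x < 1" using assms by (auto simp: Sigma_set_def)
  have rec: "\<lfloor>2 ^ Suc k * x\<rfloor> = 2 * \<lfloor>2 ^ k * x\<rfloor> + int (b (Suc k))" for k
  proof -
    have "\<lfloor>2 ^ k * x\<rfloor> = \<lfloor>2 ^ Suc k * x\<rfloor> div 2"
      using floor_divide_real_eq_div[of 2 "2 ^ Suc k * x"] by simp
    then show ?thesis by (simp add: b_def)
  qed
  have part: "(\<Sum>i<n. real (b (Suc i)) / 2 ^ Suc i) = of_int \<lfloor>2 ^ n * x\<rfloor> / 2 ^ n" for n
  proof (induction n)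
    case 0
    show ?case using x by (simp add: floor_eq_iff)
  next
    case (Suc n)
    have "(\<Sum>i<Suc n. real (b (Suc i)) / 2 ^ Suc i)
        = of_int \<lfloor>2 ^ n * x\<rfloor> / 2 ^ n + real (b (Suc n)) / 2 ^ Suc n"
      using Suc.IH by simp
    also have "\<dots> = of_int (2 * \<lfloor>2 ^ n * x\<rfloor> + int (b (Suc n))) / 2 ^ Suc n"
      by (simp add: field_simps)
    finally show ?case by (simp only: rec)
  qed
  have "(\<lambda>i. real (b (Suc i)) / 2 ^ Suc i) sums x"
    unfolding sums_def part
  proof (rule tendsto_sandwich)
    show "\<forall>\<^sub>F n in sequentially. x - (1 / 2) ^ n \<le> of_int \<lfloor>2 ^ n * x\<rfloor> / 2 ^ n"
    proof (rule always_eventually, rule allI)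
      fix n
      have "2 ^ n * x - 1 \<le> of_int \<lfloor>2 ^ n * x\<rfloor>" by linarith
      then have "(2 ^ n * x - 1) / 2 ^ n \<le> of_int \<lfloor>2 ^ n * x\<rfloor> / 2 ^ n"
        by (rule divide_right_mono) simp
      then show "x - (1 / 2) ^ n \<le> of_int \<lfloor>2 ^ n * x\<rfloor> / 2 ^ n"
        by (simp add: diff_divide_distrib power_divide)
    qed
    show "\<forall>\<^sub>F n in sequentially. of_int \<lfloor>2 ^ n * x\<rfloor> / 2 ^ n \<le> x"
    proof (rule always_eventually, rule allI)
      fix n
      have "of_int \<lfloor>2 ^ n * x\<rfloor> \<le> 2 ^ n * x" by linarith
      then show "of_int \<lfloor>2 ^ n * x\<rfloor> / 2 ^ n \<le> x"
        by (simp add: field_simps)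
    qed
    have "(\<lambda>n. x - (1 / 2) ^ n) \<longlonglongrightarrow> x - 0"
      by (intro tendsto_diff tendsto_const LIMSEQ_power_zero) simp
    then show "(\<lambda>n. x - (1 / 2) ^ n) \<longlonglongrightarrow> x" by simp
  qed simp
  moreover have "restrict b {1..} \<in> {1..} \<rightarrow>\<^sub>E {0, 1}"
    by (auto simp: b_def)
  ultimately have "is_binary_expansion x (restrict b {1..})"
    by (simp add: is_binary_expansion_def)
  then show ?thesis by blast
qed

lemma ex1_binary_expansion:
  assumes "x \<in> Sigma_set"
  shows "\<exists>!d. is_binary_expansion x d"
  using binary_expansion_exists binary_expansion_unique assms by blast

lemma binary_digit_expansion:
  assumes "x \<in> Sigma_set"
  shows "is_binary_expansion x (binary_digit x)"
  unfolding binary_digit_def by (rule theI'[OF ex1_binary_expansion[OF assms]])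


subsection \<open>The block decomposition exists and is unique\<close>

lemma block_decomposition_unique:
  assumes A: "is_block_decomposition d l m" and B: "is_block_decomposition d l' m'"
  shows "l = l' \<and> m = m'"
proof -
  have one: "one_end l m j = (LEAST n. zero_end l m j \<le> n \<and> d (Suc n) = 0)"
    if "is_block_decomposition d l m" for l m j
  proof (rule Least_equality[symmetric])
    have l: "1 \<le> l (Suc j)"
      using that by (auto simp: is_block_decomposition_def PiE_iff)
    have "Suc (one_end l m j) \<in> zero_positions l m (Suc j)"
      using l by (simp add: zero_positions_def one_end_def)
    then have "d (Suc (one_end l m j)) = 0"
      using that unfolding is_block_decomposition_def by (metis le_add1 plus_1_eq_Suc)
    then show "zero_end l m j \<le> one_end l m j \<and> d (Suc (one_end l m j)) = 0"
      by (simp add: one_end_def)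
    fix n assume n: "zero_end l m j \<le> n \<and> d (Suc n) = 0"
    show "one_end l m j \<le> n"
    proof (rule ccontr)
      assume "\<not> one_end l m j \<le> n"
      then have "Suc n \<in> one_positions l m j"
        using n by (simp add: one_positions_def)
      then have "d (Suc n) = 1"
        using that unfolding is_block_decomposition_def by blast
      then show False using n by simp
    qed
  qed
  have zero: "zero_end l m (Suc j) = (LEAST n. one_end l m j \<le> n \<and> d (Suc n) = 1)"
    if "is_block_decomposition d l m" for l m j
  proof (rule Least_equality[symmetric])
    have m: "1 \<le> m (Suc j)"
      using that by (auto simp: is_block_decomposition_def)
    have "Suc (zero_end l m (Suc j)) \<in> one_positions l m (Suc j)"
      using m by (simp add: one_positions_def one_end_def)
    then have "d (Suc (zero_end l m (Suc j))) = 1"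
      using that unfolding is_block_decomposition_def by blast
    then show "one_end l m j \<le> zero_end l m (Suc j) \<and> d (Suc (zero_end l m (Suc j))) = 1"
      by (simp add: one_end_def)
    fix n assume n: "one_end l m j \<le> n \<and> d (Suc n) = 1"
    show "zero_end l m (Suc j) \<le> n"
    proof (rule ccontr)
      assume "\<not> zero_end l m (Suc j) \<le> n"
      then have "Suc n \<in> zero_positions l m (Suc j)"
        using n by (simp add: zero_positions_def)
      then have "d (Suc n) = 0"
        using that unfolding is_block_decomposition_def by (metis le_add1 plus_1_eq_Suc)
      then show False using n by simp
    qed
  qed
  have z: "zero_end l m j = zero_end l' m' j" for j
  proof (induction j)
    case (Suc j)
    then have "one_end l m j = one_end l' m' j" by (simp only: one[OF A] one[OF B])
    then show ?case by (simp only: zero[OF A] zero[OF B])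
  qed simp
  then have o: "one_end l m j = one_end l' m' j" for j by (simp only: one[OF A] one[OF B])
  have m: "m j = m' j" for j using z[of j] o[of j] by (simp add: one_end_def)
  have "l (Suc j) = l' (Suc j)" for j
    using z[of "Suc j"] z[of j] m[of j] by simp
  then have "l n = l' n" if "n \<in> {1..}" for n
    using that by (cases n) auto
  then have "l = l'"
    using A B by (intro PiE_ext[of l "{1..}" "\<lambda>_. {1..}" l']) (auto simp: is_block_decomposition_def)
  then show ?thesis using m by auto
qed

lemma block_decomposition_exists:
  assumes range: "\<And>i. d (Suc i) \<in> {0, 1 :: nat}"
    and inf0: "\<And>k. \<exists>n\<ge>k. d (Suc n) = 0" and inf1: "\<And>k. \<exists>n\<ge>k. d (Suc n) = 1"
  shows "\<exists>l m. is_block_decomposition d l m"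
proof -
  define a where "a k = (LEAST n. k \<le> n \<and> d (Suc n) = 0)" for k
  define b where "b k = (LEAST n. k \<le> n \<and> d (Suc n) = 1)" for k
  have a: "k \<le> a k" "d (Suc (a k)) = 0" for k
    using LeastI_ex[OF inf0[of k]] by (auto simp: a_def)
  have b: "k \<le> b k" "d (Suc (b k)) = 1" for k
    using LeastI_ex[OF inf1[of k]] by (auto simp: b_def)
  have al: "d (Suc n) = 1" if "k \<le> n" "n < a k" for n k
    using not_less_Least[of n "\<lambda>n. k \<le> n \<and> d (Suc n) = 0"] that range[of n] by (auto simp: a_def)
  have bl: "d (Suc n) = 0" if "k \<le> n" "n < b k" for n k
    using not_less_Least[of n "\<lambda>n. k \<le> n \<and> d (Suc n) = 1"] that range[of n] by (auto simp: b_def)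
  define T where "T = rec_nat (a 0) (\<lambda>_ t. a (b t))"
  have T0: "T 0 = a 0" and TS: "T (Suc j) = a (b (T j))" for j by (simp_all add: T_def)
  define l where "l = restrict (\<lambda>j. b (T (j - 1)) - T (j - 1)) {1..}"
  define m where "m j = (if j = 0 then T 0 else T j - b (T (j - 1)))" for j
  have dT: "d (Suc (T j)) = 0" for j
    by (cases j) (simp_all add: T0 TS a)
  have Tb: "T j < b (T j)" for j
    using b[of "T j"] dT[of j] by (metis le_neq_implies_less zero_neq_one)
  have bT: "b (T j) < T (Suc j)" for j
    using a[of "b (T j)"] b(2)[of "T j"] unfolding TS by (metis le_neq_implies_less zero_neq_one)
  have lS: "l (Suc j) = b (T j) - T j" for j by (simp add: l_def)
  have mS: "m (Suc j) = T (Suc j) - b (T j)" for j by (simp add: m_def)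
  have ends: "one_end l m j = T j" "zero_end l m (Suc j) = b (T j)" for j
  proof (induction j)
    case 0
    show "one_end l m 0 = T 0" by (simp add: one_end_def m_def)
    show "zero_end l m (Suc 0) = b (T 0)" using Tb[of 0] by (simp add: m_def lS)
  next
    case (Suc j)
    show s: "one_end l m (Suc j) = T (Suc j)"
      using Suc bT[of j] unfolding one_end_def mS by simp
    then show "zero_end l m (Suc (Suc j)) = b (T (Suc j))"
      using Tb[of "Suc j"] unfolding zero_end.simps(2)[of l m "Suc j"] one_end_def lS by simp
  qed
  have "is_block_decomposition d l m"
    unfolding is_block_decomposition_def
  proof (intro conjI allI impI ballI)
    show "l \<in> {1..} \<rightarrow>\<^sub>E {1..}"
    proof (rule PiE_I)
      fix j :: nat assume "j \<in> {1..}"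
      then obtain i where "j = Suc i" by (cases j) auto
      then show "l j \<in> {1..}" using Tb[of i] by (simp add: lS)
    qed (simp add: l_def)
  next
    fix j :: nat assume "1 \<le> j"
    then obtain i where "j = Suc i" by (cases j) auto
    then show "1 \<le> m j" using bT[of i] by (simp add: mS)
  next
    fix j n :: nat assume "1 \<le> j" and n: "n \<in> zero_positions l m j"
    then obtain i where i: "j = Suc i" by (cases j) auto
    have "T i + 1 \<le> n" "n \<le> b (T i)"
      using n by (auto simp: zero_positions_def i ends simp del: zero_end.simps)
    then show "d n = 0" using bl[of "T i" "n - 1"] by (cases n) auto
  next
    fix j n assume n: "n \<in> one_positions l m j"
    show "d n = 1"
    proof (cases j)
      case 0
      then show ?thesis using n al[of 0 "n - 1"]
        by (cases n) (auto simp: one_positions_def ends T0)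
    next
      case (Suc i)
      have "b (T i) + 1 \<le> n" "n \<le> T (Suc i)"
        using n by (auto simp: one_positions_def Suc ends simp del: zero_end.simps)
      then show ?thesis using al[of "b (T i)" "n - 1"] by (cases n) (auto simp: TS)
    qed
  qed
  then show ?thesis by blast
qed

lemma ex1_block_decomposition:
  assumes "x \<in> Sigma_set"
  shows "\<exists>!(l, m). is_block_decomposition (binary_digit x) l m"
proof -
  note e = binary_digit_expansion[OF assms]
  obtain l m where "is_block_decomposition (binary_digit x) l m"
    using block_decomposition_exists[of "binary_digit x"] binary_expansion_range[OF e]
      binary_expansion_not_eventually[OF assms e] by blast
  then show ?thesis
    using block_decomposition_unique by (intro ex1I[of _ "(l, m)"]) auto
qed

lemma is_block_decomposition_lens:
  assumes "x \<in> Sigma_set"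
  shows "is_block_decomposition (binary_digit x) (zero_len x) (one_len x)"
  using theI'[OF ex1_block_decomposition[OF assms]]
  by (simp add: block_lengths_def zero_len_def one_len_def case_prod_unfold)

lemma zero_len_ge_1: "x \<in> Sigma_set \<Longrightarrow> j \<ge> 1 \<Longrightarrow> zero_len x j \<ge> 1"
  using is_block_decomposition_lens[of x] by (auto simp: is_block_decomposition_def PiE_iff)

lemma one_len_ge_1: "x \<in> Sigma_set \<Longrightarrow> j \<ge> 1 \<Longrightarrow> one_len x j \<ge> 1"
  using is_block_decomposition_lens[of x] by (auto simp: is_block_decomposition_def)


subsection \<open>The blocks partition the positive integers\<close>

lemma zero_end_mono: "i \<le> j \<Longrightarrow> zero_end l m i \<le> zero_end l m j"
  by (rule lift_Suc_mono_le[of "zero_end l m"]) auto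

lemma one_end_le_zero_end: "i < j \<Longrightarrow> one_end l m i \<le> zero_end l m j"
  using zero_end_mono[of "Suc i" j l m] by (simp add: one_end_def)

lemma zero_block_index_unique:
  assumes "1 \<le> i" "1 \<le> j" "n \<in> zero_block x i" "n \<in> zero_block x j"
  shows "i = j"
proof -
  have False if "i < j" "1 \<le> i" "n \<in> zero_block x i" "n \<in> zero_block x j" for i j
  proof -
    have "zero_end (zero_len x) (one_len x) i \<le> one_end (zero_len x) (one_len x) (j - 1)"
      using zero_end_mono[of i "j - 1"] that by (simp add: one_end_def trans_le_add1)
    then show False using that by (auto simp: zero_block_def zero_positions_def)
  qed
  then show ?thesis using assms by (metis linorder_neqE_nat)
qed

lemma one_block_index_unique:
  assumes "n \<in> one_block x i" "n \<in> one_block x j"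
  shows "i = j"
proof -
  have False if "i < j" "n \<in> one_block x i" "n \<in> one_block x j" for i j
    using one_end_le_zero_end[of i j "zero_len x" "one_len x"] that
    by (auto simp: one_block_def one_positions_def)
  then show ?thesis using assms by (metis linorder_neqE_nat)
qed

lemma zero_block_one_block_disjoint:
  assumes "x \<in> Sigma_set" "1 \<le> i" "n \<in> zero_block x i"
  shows "n \<notin> one_block x j"
  using is_block_decomposition_lens[OF assms(1)] assms(2,3)
  unfolding is_block_decomposition_def zero_block_def one_block_def by (metis zero_neq_one)

lemma blocks_cover:
  assumes x: "x \<in> Sigma_set" and n: "1 \<le> n"
  shows "(\<exists>j\<ge>1. n \<in> zero_block x j) \<or> (\<exists>j. n \<in> one_block x j)"
proof -
  let ?s = "zero_end (zero_len x) (one_len x)" and ?t = "one_end (zero_len x) (one_len x)"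
  have big: "j \<le> ?s j" for j
  proof (induction j)
    case (Suc j)
    then show ?case using zero_len_ge_1[OF x, of "Suc j"] by simp
  qed simp
  define j where "j = (LEAST j. n \<le> ?t j)"
  have ex: "n \<le> ?t n" using big[of n] by (simp add: one_end_def)
  then have j: "n \<le> ?t j" unfolding j_def by (rule LeastI)
  show ?thesis
  proof (cases "n \<le> ?s j")
    case False
    then have "n \<in> one_block x j" using j by (simp add: one_block_def one_positions_def)
    then show ?thesis by blast
  next
    case True
    then have "j \<noteq> 0" using n by (cases j) auto
    then have "\<not> n \<le> ?t (j - 1)"
      using not_less_Least[of "j - 1" "\<lambda>j. n \<le> ?t j"] by (simp add: j_def)
    then have "n \<in> zero_block x j" using True by (simp add: zero_block_def zero_positions_def)
    then show ?thesis using \<open>j \<noteq> 0\<close> by (metis One_nat_def Suc_leI neq0_conv)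
  qed
qed

lemma blockwise_eq:
  assumes x: "x \<in> Sigma_set"
  shows "n \<in> one_block x 0 \<union> zero_block x 1 \<union> one_block x 1 \<Longrightarrow> blockwise x f g n = 1"
    and "2 \<le> j \<Longrightarrow> n \<in> zero_block x j \<Longrightarrow> blockwise x f g n = f j"
    and "2 \<le> j \<Longrightarrow> n \<in> one_block x j \<Longrightarrow> blockwise x f g n = g j"
proof -
  show "n \<in> one_block x 0 \<union> zero_block x 1 \<union> one_block x 1 \<Longrightarrow> blockwise x f g n = 1"
    by (simp add: blockwise_def)
next
  assume j: "2 \<le> j" and n: "n \<in> zero_block x j"
  have "(THE j. j \<ge> 2 \<and> n \<in> zero_block x j) = j"
    using j n zero_block_index_unique[of _ j n x] by (intro the_equality) auto
  moreover have "n \<notin> one_block x 0 \<union> zero_block x 1 \<union> one_block x 1"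
    using j n zero_block_index_unique[of 1 j n x] zero_block_one_block_disjoint[OF x, of j n]
    by auto
  ultimately show "blockwise x f g n = f j"
    using j n by (auto simp: blockwise_def)
next
  assume j: "2 \<le> j" and n: "n \<in> one_block x j"
  have "(THE j. j \<ge> 2 \<and> n \<in> one_block x j) = j"
    using j n one_block_index_unique by (intro the_equality) blast+
  moreover have "n \<notin> one_block x 0 \<union> zero_block x 1 \<union> one_block x 1"
    using j n one_block_index_unique[of n x 0 j] one_block_index_unique[of n x 1 j]
      zero_block_one_block_disjoint[OF x, of 1 n j]
    by auto
  moreover have "\<not> (\<exists>j\<ge>2. n \<in> zero_block x j)"
    using n zero_block_one_block_disjoint[OF x, of _ n j] by (meson one_le_numeral order_trans)
  ultimately show "blockwise x f g n = g j"
    unfolding blockwise_def by (simp only: if_False)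
qed

end

theory Submission
  imports Defs
begin

text \<open>On every block \<open>\<Phi>\<^sub>1/\<Phi>\<^sub>2\<close> is, up to the additive constant \<open>m\<^sub>0\<close>, the last position of the block
  and \<open>\<Psi>\<^sub>1/\<Psi>\<^sub>2\<close> is the last position before the block.  Hence, up to constants,
  \<open>\<Psi>\<^sub>1(n)/\<Psi>\<^sub>2(n) \<le> n \<le> \<Phi>\<^sub>1(n)/\<Phi>\<^sub>2(n)\<close> always holds, and regularity says precisely that the two
  quotients are comparable.  Either of the reversed inequalities implies regularity: evaluate
  the one for \<open>\<Phi>\<close> at the first position of each block and the one for \<open>\<Psi>\<close> at the last.\<close>

section \<open>Block ends counted without the initial block of ones\<close>

definition zero_total :: "real \<Rightarrow> nat \<Rightarrow> real" where
  "zero_total x j = (\<Sum>u=1..j. real (zero_len x u)) + (\<Sum>u=1..j-1. real (one_len x u))"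

definition one_total :: "real \<Rightarrow> nat \<Rightarrow> real" where
  "one_total x j = (\<Sum>u=1..j. real (zero_len x u)) + (\<Sum>u=1..j. real (one_len x u))"

text \<open>\<open>upper_pos\<close> is the quotient of \<open>Phi1\<close> by \<open>Phi2\<close>,
  and \<open>lower_pos\<close> below that of \<open>Psi1\<close> by \<open>Psi2\<close>. The
  parameter \<open>p\<close> cancels in both, so every inequality to be compared becomes a statement
  about block lengths alone.\<close>

definition upper_pos :: "real \<Rightarrow> nat \<Rightarrow> real" where
  "upper_pos x = blockwise x (zero_total x) (one_total x)"

definition lower_pos :: "real \<Rightarrow> nat \<Rightarrow> real" where
  "lower_pos x = blockwise x (\<lambda>j. one_total x (j - 1)) (zero_total x)"

lemma zero_total_eq: "1 \<le> j \<Longrightarrow> zero_total x j = one_total x (j - 1) + real (zero_len x j)"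
  by (cases j) (simp_all add: zero_total_def one_total_def)

lemma one_total_eq: "1 \<le> j \<Longrightarrow> one_total x j = zero_total x j + real (one_len x j)"
  by (cases j) (simp_all add: zero_total_def one_total_def)

text \<open>Positions count the initial block of ones and the totals do not; the offset
  \<open>one_len x 0\<close> between them is the source of all additive constants below.\<close>

lemma one_end_eq_total:
  "real (one_end (zero_len x) (one_len x) j) = real (one_len x 0) + one_total x j"
  by (induction j) (simp_all add: one_end_def one_total_def)

lemma zero_end_eq_total:
  assumes "1 \<le> j"
  shows "real (zero_end (zero_len x) (one_len x) j) = real (one_len x 0) + zero_total x j"
  using one_end_eq_total[of x j] one_total_eq[OF assms, of x] by (simp add: one_end_def)

lemma zero_total_ge_1:
  assumes "x \<in> Sigma_set" "1 \<le> j"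
  shows "1 \<le> zero_total x j"
proof -
  have "0 \<le> one_total x (j - 1)"
    by (simp add: one_total_def sum_nonneg)
  then show ?thesis
    using zero_len_ge_1[OF assms] zero_total_eq[OF assms(2), of x] by simp
qed

lemma one_total_ge_1: "x \<in> Sigma_set \<Longrightarrow> 1 \<le> j \<Longrightarrow> 1 \<le> one_total x j"
  using zero_total_ge_1[of x j] one_total_eq[of j x] by simp

text \<open>Stated over the reals so that positions and totals can be compared by linear
  arithmetic.\<close>

lemma zero_block_iff:
  assumes "1 \<le> j"
  shows "n \<in> zero_block x j \<longleftrightarrow>
    real (one_len x 0) + one_total x (j - 1) + 1 \<le> real n \<and>
    real n \<le> real (one_len x 0) + zero_total x j"
  by (auto simp: zero_block_def zero_positions_def
      one_end_eq_total[symmetric] zero_end_eq_total[OF assms, symmetric])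

lemma one_block_iff:
  assumes "1 \<le> j"
  shows "n \<in> one_block x j \<longleftrightarrow>
    real (one_len x 0) + zero_total x j + 1 \<le> real n \<and>
    real n \<le> real (one_len x 0) + one_total x j"
  by (auto simp: one_block_def one_positions_def
      one_end_eq_total[symmetric] zero_end_eq_total[OF assms, symmetric])

text \<open>The cases are those of \<open>blockwise_eq\<close>, so each one reduces a
  \<open>blockwise\<close> function to a single formula.\<close>

lemma block_cases [consumes 2, case_names initial zeros ones]:
  assumes "x \<in> Sigma_set" "1 \<le> n"
  obtains "n \<in> one_block x 0 \<union> zero_block x 1 \<union> one_block x 1"
  | j where "2 \<le> j" "n \<in> zero_block x j"
  | j where "2 \<le> j" "n \<in> one_block x j"
  using blocks_cover[OF assms]
proof (elim disjE exE conjE)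
  fix j assume "1 \<le> j" "n \<in> zero_block x j"
  moreover from this consider "j = 1" | "2 \<le> j" by linarith
  ultimately show ?thesis using that(1,2) by cases auto
next
  fix j assume "n \<in> one_block x j"
  moreover consider "j = 0" | "j = 1" | "2 \<le> j" by linarith
  ultimately show ?thesis using that(1,3) by cases auto
qed

lemma initial_position_le:
  assumes "x \<in> Sigma_set" "n \<in> one_block x 0 \<union> zero_block x 1 \<union> one_block x 1"
  shows "real n \<le> real (one_len x 0) + one_total x 1"
proof -
  have "n \<in> one_block x 0 \<Longrightarrow> real n \<le> real (one_len x 0)"
    by (simp add: one_block_def one_positions_def one_end_def)
  then show ?thesis
    using assms(2) zero_block_iff[of 1 n x] one_block_iff[of 1 n x]
      one_total_ge_1[OF assms(1), of 1] one_total_eq[of 1 x] by auto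
qed

section \<open>Positivity and the two quotients\<close>

lemma blockwise_pos:
  assumes "x \<in> Sigma_set" "1 \<le> n" "\<And>j. 2 \<le> j \<Longrightarrow> 0 < f j" "\<And>j. 2 \<le> j \<Longrightarrow> 0 < g j"
  shows "0 < blockwise x f g n"
  using assms(1,2) by (cases rule: block_cases) (simp_all add: blockwise_eq[OF assms(1)] assms(3,4))

lemma sum_powr_pos: "1 \<le> (j::nat) \<Longrightarrow> 0 < (\<Sum>u=1..j. 2 powr (p * real (f u)))"
  by (intro sum_pos) auto

lemma Phi1_pos: "x \<in> Sigma_set \<Longrightarrow> 1 \<le> n \<Longrightarrow> 0 < Phi1 p x n"
  unfolding Phi1_def by (intro blockwise_pos add_pos_nonneg sum_powr_pos sum_nonneg) auto

lemma Psi1_pos: "x \<in> Sigma_set \<Longrightarrow> 1 \<le> n \<Longrightarrow> 0 < Psi1 p x n"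
  unfolding Psi1_def by (intro blockwise_pos add_pos_nonneg sum_powr_pos sum_nonneg) auto

lemma upper_pos_pos: "x \<in> Sigma_set \<Longrightarrow> 1 \<le> n \<Longrightarrow> 0 < upper_pos x n"
  unfolding upper_pos_def
  by (intro blockwise_pos less_le_trans[OF zero_less_one] zero_total_ge_1 one_total_ge_1) auto

lemma lower_pos_pos: "x \<in> Sigma_set \<Longrightarrow> 1 \<le> n \<Longrightarrow> 0 < lower_pos x n"
  unfolding lower_pos_def
  by (intro blockwise_pos less_le_trans[OF zero_less_one] zero_total_ge_1 one_total_ge_1) auto

text \<open>On the first three blocks the left side is 1 whatever \<open>b\<close> is; the
  assumption supplies \<open>b = 1\<close> there, so the right side is 1 as well. On the other
  blocks both sides divide \<open>b\<close> by the same number.\<close>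

lemma blockwise_divide:
  assumes "b = blockwise x f g n"
  shows "blockwise x (\<lambda>j. b / f' j) (\<lambda>j. b / g' j) n = b / blockwise x f' g' n"
  unfolding assms by (auto simp: blockwise_def)

lemma Phi2_eq: "Phi2 p x n = Phi1 p x n / upper_pos x n"
  unfolding Phi2_def upper_pos_def zero_total_def[symmetric] one_total_def[symmetric]
  by (rule blockwise_divide) (simp only: Phi1_def)

lemma Psi2_eq: "Psi2 p x n = Psi1 p x n / lower_pos x n"
  unfolding Psi2_def lower_pos_def zero_total_def[symmetric] one_total_def[symmetric]
  by (rule blockwise_divide) (simp only: Psi1_def)

section \<open>Comparisons of \<open>n\<close> with the quotients that hold for every
  \<open>x\<close> in \<open>Sigma_set\<close>\<close>

lemma lower_pos_le:
  assumes "x \<in> Sigma_set" "1 \<le> n"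
  shows "lower_pos x n \<le> real n"
  using assms
proof (cases rule: block_cases)
  case (zeros j)
  then show ?thesis using assms by (simp add: lower_pos_def blockwise_eq zero_block_iff)
next
  case (ones j)
  then show ?thesis using assms by (simp add: lower_pos_def blockwise_eq one_block_iff)
qed (use assms in \<open>simp add: lower_pos_def blockwise_eq\<close>)

text \<open>The constant is dictated by the first three blocks: there \<open>upper_pos\<close> is 1
  while \<open>n\<close> can reach \<open>one_len x 0 + one_total x 1\<close>.\<close>

lemma le_upper_pos:
  assumes x: "x \<in> Sigma_set" and n: "1 \<le> n"
  shows "real n \<le> (real (one_len x 0) + one_total x 1) * upper_pos x n"
proof -
  \<comment> \<open>On later blocks \<open>t\<close> is the total at the end of the block; since
    \<open>t\<close> and \<open>one_total x 1\<close> are at least 1, the offset and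
    \<open>t\<close> are absorbed by the two summands of the constant.\<close>
  have *: "real n \<le> (real (one_len x 0) + one_total x 1) * t"
    if "1 \<le> t" "real n \<le> real (one_len x 0) + t" for t
  proof -
    have "real (one_len x 0) * 1 \<le> real (one_len x 0) * t" "1 * t \<le> one_total x 1 * t"
      using that one_total_ge_1[OF x, of 1] by (intro mult_left_mono mult_right_mono; simp)+
    then show ?thesis unfolding distrib_right using that by linarith
  qed
  show ?thesis
    using x n
  proof (cases rule: block_cases)
    case initial
    then show ?thesis
      using initial_position_le[OF x initial] x by (simp add: upper_pos_def blockwise_eq)
  next
    case (zeros j)
    then show ?thesis
      using *[of "zero_total x j"] zero_total_ge_1[OF x] x
      by (simp add: upper_pos_def blockwise_eq zero_block_iff)
  next
    case (ones j)
    then show ?thesis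
      using *[of "one_total x j"] one_total_ge_1[OF x] x
      by (simp add: upper_pos_def blockwise_eq one_block_iff)
  qed
qed

section \<open>Regularity as comparability of consecutive block ends\<close>

lemma regular_decomposition_iff_totals:
  assumes x: "x \<in> Sigma_set"
  shows "regular_decomposition x \<longleftrightarrow>
    (\<exists>C. \<forall>j\<ge>2. zero_total x j \<le> C * one_total x (j - 1) \<and> one_total x j \<le> C * zero_total x j)"
    (is "_ \<longleftrightarrow> (\<exists>C. ?P C)")
proof -
  have reg: "regular_decomposition x \<longleftrightarrow> (\<exists>C>0. \<forall>j\<ge>2.
      real (zero_len x j) / one_total x (j - 1) \<le> C \<and> real (one_len x j) / zero_total x j \<le> C)"
    by (simp add: regular_decomposition_def zero_total_def one_total_def)
  \<comment> \<open>Adding 1 to a regularity ratio gives the quotient of the totals at the end of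
    the block and just before it.\<close>
  have step: "real (zero_len x j) / one_total x (j - 1) \<le> C \<longleftrightarrow>
        zero_total x j \<le> (C + 1) * one_total x (j - 1)"
      "real (one_len x j) / zero_total x j \<le> C \<longleftrightarrow>
        one_total x j \<le> (C + 1) * zero_total x j" if "2 \<le> j" for j C
  proof -
    have "0 < one_total x (j - 1)" "0 < zero_total x j"
      using that one_total_ge_1[OF x, of "j - 1"] zero_total_ge_1[OF x, of j] by linarith+
    then show "real (zero_len x j) / one_total x (j - 1) \<le> C \<longleftrightarrow>
        zero_total x j \<le> (C + 1) * one_total x (j - 1)"
      "real (one_len x j) / zero_total x j \<le> C \<longleftrightarrow>
        one_total x j \<le> (C + 1) * zero_total x j"
      using that by (simp_all add: pos_divide_le_eq distrib_right zero_total_eq one_total_eq[of j x])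
  qed
  show ?thesis
  proof
    assume "regular_decomposition x"
    then show "\<exists>C. ?P C" unfolding reg using step by blast
  next
    assume "\<exists>C. ?P C"
    then obtain C where C: "?P C" by blast
    \<comment> \<open>Regularity asks for a positive constant and \<open>C - 1\<close> may fail to
      be one; the maximum is positive, and \<open>max 1 (C - 1) + 1\<close> is still at least
      \<open>C\<close>.\<close>
    have "?P (max 1 (C - 1) + 1)"
    proof (intro allI impI)
      fix j :: nat assume j: "2 \<le> j"
      have "C * one_total x (j - 1) \<le> (max 1 (C - 1) + 1) * one_total x (j - 1)"
        "C * zero_total x j \<le> (max 1 (C - 1) + 1) * zero_total x j"
        using j one_total_ge_1[OF x, of "j - 1"] zero_total_ge_1[OF x, of j]
        by (intro mult_right_mono; linarith)+
      then show "zero_total x j \<le> (max 1 (C - 1) + 1) * one_total x (j - 1) \<and>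
          one_total x j \<le> (max 1 (C - 1) + 1) * zero_total x j"
        using C j by (meson order_trans)
    qed
    then show "regular_decomposition x"
      unfolding reg using step by (intro exI[of _ "max 1 (C - 1)"]) auto
  qed
qed

text \<open>Within a block from the second pair on, the two quotients are the consecutive totals at
  its end and before its start.\<close>

lemma regular_upper_le_lower:
  assumes x: "x \<in> Sigma_set" and "regular_decomposition x"
  obtains C where "0 < C" "\<And>n. 1 \<le> n \<Longrightarrow> upper_pos x n \<le> C * lower_pos x n"
proof -
  obtain C where C: "\<And>j. 2 \<le> j \<Longrightarrow>
      zero_total x j \<le> C * one_total x (j - 1) \<and> one_total x j \<le> C * zero_total x j"
    using assms regular_decomposition_iff_totals by blast
  have "upper_pos x n \<le> max 1 C * lower_pos x n" if n: "1 \<le> n" for n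
  proof -
    have "C * lower_pos x n \<le> max 1 C * lower_pos x n"
      using lower_pos_pos[OF x n] by (intro mult_right_mono) auto
    \<comment> \<open>The first alternative serves the first three blocks, where both quotients are
      1; the second serves all other blocks.\<close>
    moreover have "upper_pos x n \<le> max 1 C * lower_pos x n \<or> upper_pos x n \<le> C * lower_pos x n"
      using x n
    proof (cases rule: block_cases)
      case (zeros j)
      then show ?thesis using C[of j] x by (simp add: upper_pos_def lower_pos_def blockwise_eq)
    next
      case (ones j)
      then show ?thesis using C[of j] x by (simp add: upper_pos_def lower_pos_def blockwise_eq)
    qed (use x in \<open>simp add: upper_pos_def lower_pos_def blockwise_eq\<close>)
    ultimately show ?thesis by linarith
  qed
  then show ?thesis using that[of "max 1 C"] by simp
qed

text \<open>Since \<open>t\<close> is at least 1, \<open>m + 1\<close> is at most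
  \<open>(m + 1) * t\<close>. This removes the offset carried by the first position of a block, with
  \<open>m\<close> the length of the initial block of ones.\<close>

lemma first_position_bound:
  fixes a m t u :: real
  assumes "0 < a" "0 \<le> m" "1 \<le> t" "u \<le> a * (m + t + 1)"
  shows "u \<le> a * (m + 2) * t"
proof -
  have "m \<le> m * t"
    using assms by (intro mult_left_mono[of 1 t m, simplified])
  then have "a * (m + t + 1) \<le> a * ((m + 2) * t)"
    using assms by (intro mult_left_mono) (auto simp: distrib_right)
  then show ?thesis using assms(4) by (simp add: mult.assoc)
qed

section \<open>Regularity from either reversed inequality\<close>

lemma regular_iff_upper_pos_le:
  assumes x: "x \<in> Sigma_set"
  shows "regular_decomposition x \<longleftrightarrow> (\<exists>a>0. \<forall>n\<ge>1. upper_pos x n \<le> a * real n)"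
proof
  assume "regular_decomposition x"
  then obtain C where C: "0 < C" "\<And>n. 1 \<le> n \<Longrightarrow> upper_pos x n \<le> C * lower_pos x n"
    using regular_upper_le_lower[OF x] by blast
  have "upper_pos x n \<le> C * real n" if "1 \<le> n" for n
    using C(2)[OF that] mult_left_mono[OF lower_pos_le[OF x that], of C] C(1) by linarith
  then show "\<exists>a>0. \<forall>n\<ge>1. upper_pos x n \<le> a * real n"
    using C(1) by blast
next
  assume "\<exists>a>0. \<forall>n\<ge>1. upper_pos x n \<le> a * real n"
  then obtain a where a: "0 < a" "\<And>n. 1 \<le> n \<Longrightarrow> upper_pos x n \<le> a * real n" by blast
  show "regular_decomposition x"
    unfolding regular_decomposition_iff_totals[OF x]
  proof (intro exI allI impI conjI)
    fix j :: nat assume j: "2 \<le> j"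
    let ?s = "zero_end (zero_len x) (one_len x) j" and ?t = "one_end (zero_len x) (one_len x) (j - 1)"
    have s: "real ?s = real (one_len x 0) + zero_total x j"
      and t: "real ?t = real (one_len x 0) + one_total x (j - 1)"
      using j zero_end_eq_total one_end_eq_total by auto
    \<comment> \<open>\<open>upper_pos\<close> is constant on the block, so its bound by a multiple
      of \<open>n\<close> is sharpest at the first position.\<close>
    have "Suc ?t \<in> zero_block x j"
      using j t zero_total_eq[of j x] zero_len_ge_1[OF x, of j] by (simp add: zero_block_iff)
    then have "zero_total x j \<le> a * (real (one_len x 0) + one_total x (j - 1) + 1)"
      using a(2)[of "Suc ?t"] j x t by (simp add: upper_pos_def blockwise_eq add_ac)
    then show "zero_total x j \<le> a * (real (one_len x 0) + 2) * one_total x (j - 1)"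
      using a(1) j one_total_ge_1[OF x, of "j - 1"] by (intro first_position_bound) auto
    have "Suc ?s \<in> one_block x j"
      using j s one_total_eq[of j x] one_len_ge_1[OF x, of j] by (simp add: one_block_iff)
    then have "one_total x j \<le> a * (real (one_len x 0) + zero_total x j + 1)"
      using a(2)[of "Suc ?s"] j x s by (simp add: upper_pos_def blockwise_eq add_ac)
    then show "one_total x j \<le> a * (real (one_len x 0) + 2) * zero_total x j"
      using a(1) j zero_total_ge_1[OF x, of j] by (intro first_position_bound) auto
  qed
qed

lemma regular_iff_le_lower_pos:
  assumes x: "x \<in> Sigma_set"
  shows "regular_decomposition x \<longleftrightarrow> (\<exists>b>0. \<forall>n\<ge>1. real n \<le> b * lower_pos x n)"
proof
  let ?c = "real (one_len x 0) + one_total x 1"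
  have c: "0 < ?c" using one_total_ge_1[OF x, of 1] by simp
  assume "regular_decomposition x"
  then obtain C where C: "0 < C" "\<And>n. 1 \<le> n \<Longrightarrow> upper_pos x n \<le> C * lower_pos x n"
    using regular_upper_le_lower[OF x] by blast
  \<comment> \<open>Chains the unconditional bound of \<open>n\<close> by \<open>upper_pos\<close>
    with the bound of \<open>upper_pos\<close> by \<open>lower_pos\<close> that regularity
    gives.\<close>
  have "real n \<le> ?c * C * lower_pos x n" if "1 \<le> n" for n
    using order_trans[OF le_upper_pos[OF x that] mult_left_mono[OF C(2)[OF that], of ?c]] c
    unfolding mult.assoc by simp
  then show "\<exists>b>0. \<forall>n\<ge>1. real n \<le> b * lower_pos x n"
    using c C(1) by (intro exI[of _ "?c * C"]) auto
next
  assume "\<exists>b>0. \<forall>n\<ge>1. real n \<le> b * lower_pos x n"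
  then obtain b where b: "\<And>n. 1 \<le> n \<Longrightarrow> real n \<le> b * lower_pos x n" by blast
  show "regular_decomposition x"
    unfolding regular_decomposition_iff_totals[OF x]
  proof (intro exI allI impI conjI)
    fix j :: nat assume j: "2 \<le> j"
    let ?s = "zero_end (zero_len x) (one_len x) j" and ?t = "one_end (zero_len x) (one_len x) j"
    have s: "real ?s = real (one_len x 0) + zero_total x j"
      and t: "real ?t = real (one_len x 0) + one_total x j"
      using j zero_end_eq_total one_end_eq_total by auto
    have s1: "1 \<le> ?s" and t1: "1 \<le> ?t"
      using s t j zero_total_ge_1[OF x, of j] one_total_ge_1[OF x, of j] by linarith+
    \<comment> \<open>At the last position \<open>n\<close> is the total plus a nonnegative offset;
      dropping the offset lets \<open>b\<close> itself serve as the constant.\<close>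
    have "?s \<in> zero_block x j"
      using j s zero_total_eq[of j x] zero_len_ge_1[OF x, of j] by (simp add: zero_block_iff)
    then show "zero_total x j \<le> b * one_total x (j - 1)"
      using b[OF s1] j x s by (simp add: lower_pos_def blockwise_eq)
    have "?t \<in> one_block x j"
      using j t one_total_eq[of j x] one_len_ge_1[OF x, of j] by (simp add: one_block_iff)
    then show "one_total x j \<le> b * zero_total x j"
      using b[OF t1] j x t by (simp add: lower_pos_def blockwise_eq)
  qed
qed

section \<open>The equivalences, each between (i) and one of (ii) to (v)\<close>

theorem theorem3p12:
  fixes p x :: real
  assumes "0 < p" and "x \<in> Sigma_set"
  shows
    "(regular_decomposition x \<longleftrightarrow>
        (\<exists>a>0. \<forall>n\<ge>1. Phi1 p x n \<le> a * real n * Phi2 p x n)) \<and>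
     (regular_decomposition x \<longleftrightarrow>
        (\<exists>b>0. \<forall>n\<ge>1. real n * Psi2 p x n \<le> b * Psi1 p x n)) \<and>
     (regular_decomposition x \<longleftrightarrow>
        (\<exists>a1>0. \<exists>a2>0. \<forall>n\<ge>1.
           a1 * real n * Phi2 p x n \<le> Phi1 p x n \<and> Phi1 p x n \<le> a2 * real n * Phi2 p x n)) \<and>
     (regular_decomposition x \<longleftrightarrow>
        (\<exists>b1>0. \<exists>b2>0. \<forall>n\<ge>1.
           b1 * real n * Psi2 p x n \<le> Psi1 p x n \<and> Psi1 p x n \<le> b2 * real n * Psi2 p x n))"
proof -
  note x = assms(2)
  \<comment> \<open>Cancelling the positive factor \<open>Phi1 p x n\<close> or
    \<open>Psi1 p x n\<close> leaves inequalities between \<open>n\<close> and a quotient.\<close>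
  have phi: "Phi1 p x n \<le> a * real n * Phi2 p x n \<longleftrightarrow> upper_pos x n \<le> a * real n"
      "a * real n * Phi2 p x n \<le> Phi1 p x n \<longleftrightarrow> a * real n \<le> upper_pos x n"
    and psi: "real n * Psi2 p x n \<le> a * Psi1 p x n \<longleftrightarrow> real n \<le> a * lower_pos x n"
      "Psi1 p x n \<le> a * real n * Psi2 p x n \<longleftrightarrow> lower_pos x n \<le> a * real n"
      "a * real n * Psi2 p x n \<le> Psi1 p x n \<longleftrightarrow> a * real n \<le> lower_pos x n"
    if "1 \<le> n" for n a
    using Phi1_pos[OF x that, of p] Psi1_pos[OF x that, of p]
      upper_pos_pos[OF x that] lower_pos_pos[OF x that]
    by (simp_all add: Phi2_eq Psi2_eq field_simps)
  let ?c = "real (one_len x 0) + one_total x 1"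
  have c: "0 < ?c" using one_total_ge_1[OF x, of 1] by simp
  \<comment> \<open>The half of (iv) that goes beyond (ii) always holds.\<close>
  have up: "\<exists>a1>0. \<forall>n\<ge>1. a1 * real n \<le> upper_pos x n"
    using c le_upper_pos[OF x] by (intro exI[of _ "1 / ?c"]) (simp add: pos_divide_le_eq mult.commute)
  \<comment> \<open>Passing to the reciprocal constant identifies (iii) with one half of (v); the
    other half, \<open>lown\<close>, always holds.\<close>
  have low: "(\<exists>b>0. \<forall>n\<ge>1. real n \<le> b * lower_pos x n) \<longleftrightarrow>
      (\<exists>b>0. \<forall>n\<ge>1. b * real n \<le> lower_pos x n)"
  proof
    assume "\<exists>b>0. \<forall>n\<ge>1. real n \<le> b * lower_pos x n"
    then obtain b where "0 < b" "\<forall>n\<ge>1. real n \<le> b * lower_pos x n" by blast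
    then show "\<exists>b>0. \<forall>n\<ge>1. b * real n \<le> lower_pos x n"
      by (intro exI[of _ "1 / b"]) (simp add: pos_divide_le_eq mult.commute)
  next
    assume "\<exists>b>0. \<forall>n\<ge>1. b * real n \<le> lower_pos x n"
    then obtain b where "0 < b" "\<forall>n\<ge>1. b * real n \<le> lower_pos x n" by blast
    then show "\<exists>b>0. \<forall>n\<ge>1. real n \<le> b * lower_pos x n"
      by (intro exI[of _ "1 / b"]) (simp add: pos_le_divide_eq mult.commute)
  qed
  have lown: "\<exists>b>0. \<forall>n\<ge>1. lower_pos x n \<le> b * real n"
    using lower_pos_le[OF x] by (intro exI[of _ 1]) simp
  show ?thesis
  proof (intro conjI)
    show "regular_decomposition x \<longleftrightarrow> (\<exists>a>0. \<forall>n\<ge>1. Phi1 p x n \<le> a * real n * Phi2 p x n)"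
      by (simp add: regular_iff_upper_pos_le[OF x] phi cong: imp_cong)
    show "regular_decomposition x \<longleftrightarrow> (\<exists>b>0. \<forall>n\<ge>1. real n * Psi2 p x n \<le> b * Psi1 p x n)"
      by (simp add: regular_iff_le_lower_pos[OF x] psi cong: imp_cong)
    show "regular_decomposition x \<longleftrightarrow>
        (\<exists>a1>0. \<exists>a2>0. \<forall>n\<ge>1.
           a1 * real n * Phi2 p x n \<le> Phi1 p x n \<and> Phi1 p x n \<le> a2 * real n * Phi2 p x n)"
      using up by (simp add: regular_iff_upper_pos_le[OF x] phi cong: imp_cong) blast
    show "regular_decomposition x \<longleftrightarrow>
        (\<exists>b1>0. \<exists>b2>0. \<forall>n\<ge>1.
           b1 * real n * Psi2 p x n \<le> Psi1 p x n \<and> Psi1 p x n \<le> b2 * real n * Psi2 p x n)"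
    proof -
      have "regular_decomposition x \<longleftrightarrow>
          (\<exists>b1>0. \<exists>b2>0. \<forall>n\<ge>1. b1 * real n \<le> lower_pos x n \<and> lower_pos x n \<le> b2 * real n)"
        unfolding regular_iff_le_lower_pos[OF x] low using lown by blast
      then show ?thesis by (simp add: psi cong: imp_cong)
    qed
  qed
qed

end
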